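(* For every integer $n \ge 2$, $\pi(n) = \vartheta(\mathrm{PR}[n])$, where $\pi(n)$ is the number of primes $p \le n$, $\mathrm{PR}[n]$ is the graph with vertex set $\{2,3,\ldots,n\}$ in which two distinct vertices $v,w$ are adjacent if and only if $\gcd(v,w) > 1$, and $\vartheta$ denotes the Lov\'{a}sz theta function of a graph.
   Context: For an integer $n\ge 2$, $\mathrm{PR}[n]$ is the simple undirected graph with vertex set $\{2,3,\ldots,n\}$ in which two distinct vertices are adjacent if and only if they have a non-trivial common factor, i.e. their greatest common divisor is greater than $1$. An orthonormal representation of a finite graph $G$ is an assignment of a unit vector $\hat{x}_v$ (in a real Euclidean space $\mathbb{R}^d$, for some finite dimension $d$, the same for all vertices) to each vertex $v \in V(G)$ such that $\hat{x}_v \cdot \hat{x}_w = 0$ whenever $v$ and $w$ are distinct non-adjacent vertices. (Vectors assigned to adjacent vertices are unrestricted, and need not be distinct.) The Lov\'{a}sz theta function of $G$ is \[ \vartheta(G) = \min_{\hat{c},\{\hat{x}_v\}} \ \max_{v\in V(G)} \frac{1}{(\hat{c}\cdot \hat{x}_v)^2}, \] where the minimum is over all orthonormal representations $\{\hat{x}_v : v \in V(G)\}$ of $G$ (in any finite dimension $d$) and all unit vectors $\hat{c}$ in the same space $\mathbb{R}^d$, with the convention that $1/0 = +\infty$. *)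

theory Defs
  imports
    "HOL-Computational_Algebra.Primes"
    "HOL-Library.Extended_Real"
    "Jordan_Normal_Form.Matrix"
    "Graph_Theory.Pair_Digraph"
begin

definition prime_pi :: "nat \<Rightarrow> nat" where
  "prime_pi n = card {p. prime p \<and> p \<le> n}"

text \<open>A finite simple undirected graph is a \<^locale>\<open>pair_graph\<close>: each edge is stored as
  the two arcs \<open>(v, w)\<close> and \<open>(w, v)\<close>, and there are no loops.\<close>

definition PR :: "nat \<Rightarrow> nat pair_pre_digraph" where
  "PR n = \<lparr> pverts = {2..n},
            parcs = {(v, w). v \<in> {2..n} \<and> w \<in> {2..n} \<and> v \<noteq> w \<and> gcd v w > 1} \<rparr>"

lemma pair_graph_PR: "pair_graph (PR n)"
proof
  show "finite (parcs (PR n))"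
    by (rule finite_subset[of _ "{2..n} \<times> {2..n}"]) (auto simp: PR_def)
  show "symmetric (with_proj (PR n))"
    by (auto simp: symmetric_def sym_def PR_def gcd.commute)
qed (auto simp: PR_def)

text \<open>Vectors of \<open>\<real>\<^sup>d\<close> are elements of \<^term>\<open>carrier_vec d\<close>, since the
  dimension \<open>d\<close> is quantified over below.\<close>

definition unit_vector :: "nat \<Rightarrow> real vec \<Rightarrow> bool" where
  "unit_vector d x \<longleftrightarrow> x \<in> carrier_vec d \<and> sqrt (x \<bullet> x) = 1"

definition orthonormal_rep :: "'a pair_pre_digraph \<Rightarrow> nat \<Rightarrow> ('a \<Rightarrow> real vec) \<Rightarrow> bool" where
  "orthonormal_rep G d x \<longleftrightarrow>
     (\<forall>v \<in> pverts G. unit_vector d (x v)) \<and>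
     (\<forall>v \<in> pverts G. \<forall>w \<in> pverts G. v \<noteq> w \<and> (v, w) \<notin> parcs G \<longrightarrow> x v \<bullet> x w = 0)"

text \<open>For finite graphs with at least one vertex. Division in \<^typ>\<open>ereal\<close> satisfies
  \<open>1 / 0 = \<infinity>\<close>.\<close>

definition rep_value :: "'a pair_pre_digraph \<Rightarrow> real vec \<Rightarrow> ('a \<Rightarrow> real vec) \<Rightarrow> ereal" where
  "rep_value G c x = Max ((\<lambda>v. 1 / ereal ((c \<bullet> x v)\<^sup>2)) ` pverts G)"

text \<open>The theta function is a minimum, not merely an infimum. Accordingly \<open>LEAST\<close> is used,
  about which nothing can be deduced unless a least value exists.\<close>

definition lovasz_theta :: "'a pair_pre_digraph \<Rightarrow> ereal" where
  "lovasz_theta G =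
     (LEAST t. \<exists>d c x. unit_vector d c \<and> orthonormal_rep G d x \<and> t = rep_value G c x)"

end

theory Submission
  imports Defs
begin

text \<open>The primes up to \<open>n\<close> are independent in \<open>PR n\<close>, so the vectors of an orthonormal
  representation at the primes are orthonormal, and Bessel's inequality forces one of them to have
  squared inner product at most \<open>1 / \<pi>(n)\<close> with the handle \<open>c\<close>. Conversely, the multiples of a
  prime form a clique: sending each vertex to the basis vector of one of its prime factors, with
  all these basis vectors making the same angle with \<open>c\<close>, attains the value \<open>\<pi>(n)\<close>.\<close>

lemma unit_vector_iff: "unit_vector d x \<longleftrightarrow> x \<in> carrier_vec d \<and> x \<bullet> x = 1"
  by (simp add: unit_vector_def)

text \<open>With \<open>s\<close> the orthogonal projection of \<open>c\<close> onto the span of the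
  \<open>x p\<close>, the squared length of \<open>c - s\<close> is nonnegative and expands to the
  right side minus the left side.\<close>

lemma bessel_inequality:
  fixes c :: "real vec" and x :: "'a \<Rightarrow> real vec"
  assumes P: "finite P" and c: "c \<in> carrier_vec d"
    and x: "\<And>p. p \<in> P \<Longrightarrow> x p \<in> carrier_vec d"
    and ortho: "\<And>p q. p \<in> P \<Longrightarrow> q \<in> P \<Longrightarrow> x p \<bullet> x q = (if p = q then 1 else 0)"
  shows "(\<Sum>p\<in>P. (c \<bullet> x p)\<^sup>2) \<le> c \<bullet> c"
proof -
  define a where "a p = c \<bullet> x p" for p
  define s where "s i = (\<Sum>p\<in>P. a p * x p $ i)" for i
  have a: "a p = (\<Sum>i<d. c $ i * x p $ i)" if "p \<in> P" for p
    using x[OF that] by (simp add: a_def scalar_prod_def lessThan_atLeast0)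
  have xx: "(\<Sum>i<d. x p $ i * x q $ i) = (if p = q then 1 else 0)" if "p \<in> P" "q \<in> P" for p q
    using x[OF that(2)] ortho[OF that] by (simp add: scalar_prod_def lessThan_atLeast0)
  have "(\<Sum>i<d. c $ i * s i) = (\<Sum>p\<in>P. a p * (\<Sum>i<d. c $ i * x p $ i))"
    unfolding s_def sum_distrib_left by (subst sum.swap) (simp add: mult_ac)
  also have "\<dots> = (\<Sum>p\<in>P. (a p)\<^sup>2)"
    by (simp add: a power2_eq_square)
  finally have cs: "(\<Sum>i<d. c $ i * s i) = (\<Sum>p\<in>P. (a p)\<^sup>2)" .
  \<comment> \<open>By orthonormality \<open>s\<close> has the same inner product \<open>a p\<close>
    with each \<open>x p\<close> as \<open>c\<close> does, so this sum agrees with the cross term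
    \<open>cs\<close>.\<close>
  have "(\<Sum>i<d. s i * s i) = (\<Sum>p\<in>P. a p * (\<Sum>i<d. s i * x p $ i))"
    by (subst (2) s_def, unfold sum_distrib_left, subst sum.swap) (simp add: mult_ac)
  also have "\<dots> = (\<Sum>p\<in>P. (a p)\<^sup>2)"
  proof (rule sum.cong)
    fix p assume p: "p \<in> P"
    have "(\<Sum>i<d. s i * x p $ i) = (\<Sum>q\<in>P. a q * (\<Sum>i<d. x q $ i * x p $ i))"
      unfolding s_def sum_distrib_left sum_distrib_right by (subst sum.swap) (simp add: mult_ac)
    also have "\<dots> = (\<Sum>q\<in>P. if q = p then a q else 0)"
      by (rule sum.cong) (auto simp: xx p)
    also have "\<dots> = a p"
      using P p by simp
    finally show "a p * (\<Sum>i<d. s i * x p $ i) = (a p)\<^sup>2"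
      by (simp add: power2_eq_square)
  qed simp
  finally have ss: "(\<Sum>i<d. s i * s i) = (\<Sum>p\<in>P. (a p)\<^sup>2)" .
  have cc: "c \<bullet> c = (\<Sum>i<d. c $ i * c $ i)"
    using c by (simp add: scalar_prod_def lessThan_atLeast0)
  have "0 \<le> (\<Sum>i<d. (c $ i - s i)\<^sup>2)"
    by (simp add: sum_nonneg)
  also have "\<dots> = c \<bullet> c - 2 * (\<Sum>i<d. c $ i * s i) + (\<Sum>i<d. s i * s i)"
    by (simp add: cc power2_eq_square algebra_simps sum.distrib sum_subtractf sum_distrib_left)
  finally show ?thesis
    by (simp add: cs ss a_def)
qed

text \<open>Independence makes the vectors on \<open>P\<close> orthonormal, so their squared inner
  products with \<open>c\<close> sum to at most 1, and the smallest is at most the average.\<close>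

lemma card_independent_le_rep_value:
  assumes V: "finite (pverts G)" and P: "P \<subseteq> pverts G" "P \<noteq> {}"
    and indep: "\<And>p q. p \<in> P \<Longrightarrow> q \<in> P \<Longrightarrow> p \<noteq> q \<Longrightarrow> (p, q) \<notin> parcs G"
    and c: "unit_vector d c" and x: "orthonormal_rep G d x"
  shows "ereal (card P) \<le> rep_value G c x"
proof -
  have fin: "finite P"
    using V P finite_subset by blast
  then have k: "card P > 0"
    using P by (simp add: card_gt_0_iff)
  have "(\<Sum>p\<in>P. (c \<bullet> x p)\<^sup>2) \<le> c \<bullet> c"
    by (rule bessel_inequality[of P c d])
      (use P fin c x indep in \<open>auto simp: orthonormal_rep_def unit_vector_iff subset_iff\<close>)
  then have le: "(\<Sum>p\<in>P. (c \<bullet> x p)\<^sup>2) \<le> (\<Sum>p\<in>P. 1 / card P)"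
    using c k by (simp add: unit_vector_iff)
  \<comment> \<open>If every square exceeded \<open>1 / card P\<close>, strict monotonicity of sums
    would contradict \<open>le\<close>.\<close>
  obtain p where p: "p \<in> P" "(c \<bullet> x p)\<^sup>2 \<le> 1 / card P"
    using sum_strict_mono[OF fin P(2), of "\<lambda>_. 1 / card P" "\<lambda>p. (c \<bullet> x p)\<^sup>2"] le
    by (meson not_le)
  have "ereal (card P) \<le> 1 / ereal ((c \<bullet> x p)\<^sup>2)"
  \<comment> \<open>A zero inner product yields \<open>1 / 0 = \<infinity>\<close>, which lies above
    every bound.\<close>
  proof (cases "c \<bullet> x p = 0")
    case False
    then show ?thesis
      using p(2) k by (simp add: one_ereal_def field_simps)
  qed (simp add: divide_ereal_def)
  also have "\<dots> \<le> rep_value G c x"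
    unfolding rep_value_def using V P p by (intro Max_ge) auto
  finally show ?thesis .
qed

text \<open>The fibres of \<open>f\<close> are cliques, so distinct non-adjacent vertices have
  different labels and receive orthogonal basis vectors. Labels are natural numbers so that they can
  serve as coordinate indices.\<close>

lemma clique_cover_rep_value:
  fixes I :: "nat set" and f :: "'a \<Rightarrow> nat"
  assumes I: "finite I" and V: "pverts G \<noteq> {}" and f: "\<And>v. v \<in> pverts G \<Longrightarrow> f v \<in> I"
    and clique: "\<And>v w. v \<in> pverts G \<Longrightarrow> w \<in> pverts G \<Longrightarrow> v \<noteq> w \<Longrightarrow> f v = f w \<Longrightarrow> (v, w) \<in> parcs G"
  shows "\<exists>d c x. unit_vector d c \<and> orthonormal_rep G d x \<and> ereal (card I) = rep_value G c x"
proof -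
  obtain d where d: "I \<subseteq> {..<d}"
    using I finite_nat_iff_bounded by blast
  have k: "card I > 0"
    using I V f by (auto simp: card_gt_0_iff)
  \<comment> \<open>The weight spreads unit length evenly over the coordinates in \<open>I\<close>;
    \<open>I\<close> may have gaps below \<open>d\<close>, and those coordinates get 0.\<close>
  define c where "c = vec d (\<lambda>i. if i \<in> I then 1 / sqrt (card I) else 0)"
  define x where "x v = (unit_vec d (f v) :: real vec)" for v
  have fd: "f v < d" if "v \<in> pverts G" for v
    using f[OF that] d by auto
  have "c \<bullet> c = (\<Sum>i<d. if i \<in> I then 1 / card I else 0)"
    by (auto simp: c_def scalar_prod_def lessThan_atLeast0 intro!: sum.cong)
  also have "\<dots> = (\<Sum>i\<in>I. 1 / card I)"
    using d by (simp add: sum.If_cases Int_absorb1)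
  finally have "unit_vector d c"
    using k by (simp add: unit_vector_iff c_def)
  moreover have "orthonormal_rep G d x"
    unfolding orthonormal_rep_def unit_vector_iff
    using fd clique by (auto simp: x_def) metis
  \<comment> \<open>\<open>c \<bullet> x v\<close> is the coordinate of \<open>c\<close> at
    \<open>f v\<close>, the same for every vertex, so the maximum runs over a single value.\<close>
  moreover have "1 / ereal ((c \<bullet> x v)\<^sup>2) = ereal (card I)" if "v \<in> pverts G" for v
    using k fd[OF that] f[OF that] by (simp add: x_def c_def power_divide one_ereal_def)
  then have "(\<lambda>v. 1 / ereal ((c \<bullet> x v)\<^sup>2)) ` pverts G = {ereal (card I)}"
    using V by auto
  then have "ereal (card I) = rep_value G c x"
    by (simp add: rep_value_def)
  ultimately show ?thesis
    by blast
qed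

theorem theorem0p1:
  fixes n :: nat
  assumes "n \<ge> 2"
  shows "ereal (real (prime_pi n)) = lovasz_theta (PR n)"
proof -
  define P where "P = {p :: nat. prime p \<and> p \<le> n}"
  have P: "P \<subseteq> pverts (PR n)"
    by (auto simp: P_def PR_def prime_ge_2_nat)
  have V: "finite (pverts (PR n))" "pverts (PR n) \<noteq> {}"
    using assms by (auto simp: PR_def)
  \<comment> \<open>Averaging over \<open>P\<close> needs it to be nonempty.\<close>
  have "2 \<in> P"
    using assms by (simp add: P_def)
  obtain f where f: "prime (f v)" "f v dvd v" if "v \<noteq> 1" for v :: nat
    using prime_factor_nat by metis
  have "ereal (card P) = lovasz_theta (PR n)"
    unfolding lovasz_theta_def
  \<comment> \<open>\<open>LEAST\<close> is pinned down by a representation attaining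
    \<open>card P\<close> together with \<open>card P\<close> bounding all values from
    below.\<close>
  proof (rule Least_equality[symmetric])
    show "\<exists>d c x. unit_vector d c \<and> orthonormal_rep (PR n) d x \<and> ereal (card P) = rep_value (PR n) c x"
    proof (rule clique_cover_rep_value[where f = f])
      show "finite P"
        using P V(1) finite_subset by blast
      show "f v \<in> P" if "v \<in> pverts (PR n)" for v
        using f[of v] that by (auto simp: P_def PR_def dest!: dvd_imp_le)
      show "(v, w) \<in> parcs (PR n)"
        if "v \<in> pverts (PR n)" "w \<in> pverts (PR n)" "v \<noteq> w" "f v = f w" for v w
      proof -
        have vw: "v \<in> {2..n}" "w \<in> {2..n}"
          using that by (auto simp: PR_def)
        then have "f v dvd gcd v w"
          using f(2)[of v] f(2)[of w] \<open>f v = f w\<close> by auto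
        moreover have "f v > 1"
          using f(1)[of v] vw prime_gt_1_nat by auto
        \<comment> \<open>Divisibility gives \<open>f v \<le> gcd v w\<close> only when the gcd is
          nonzero.\<close>
        moreover have "gcd v w > 0"
          using vw by auto
        ultimately have "gcd v w > 1"
          by (meson dvd_imp_le less_le_trans)
        then show ?thesis
          using vw \<open>v \<noteq> w\<close> by (simp add: PR_def)
      qed
    qed (fact V(2))
  next
    fix t
    assume "\<exists>d c x. unit_vector d c \<and> orthonormal_rep (PR n) d x \<and> t = rep_value (PR n) c x"
    moreover have "(p, q) \<notin> parcs (PR n)" if "p \<in> P" "q \<in> P" "p \<noteq> q" for p q
      using primes_coprime[of p q] that by (auto simp: P_def PR_def)
    ultimately show "ereal (card P) \<le> t"
      using card_independent_le_rep_value[OF V(1) P] \<open>2 \<in> P\<close> by blast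
  qed
  then show ?thesis
    by (simp add: prime_pi_def P_def)
qed

end
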